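(* Let $m$ and $n$ be coprime positive integers and let $\delta$ be a real number with $\sin\delta\neq 0$. Then the polynomial $$T_n(x)^2-2T_n(x)T_m(y)\cos\delta+T_m(y)^2-\sin^2\delta\in\mathbb{R}[x,y]$$ is irreducible over $\mathbb{R}$.
   Context: For a nonnegative integer $k$, $T_k$ denotes the $k$-th Chebyshev polynomial of the first kind, i.e. the unique polynomial with $T_k(\cos\theta)=\cos k\theta$ for all real $\theta$. *)

theory Defs
  imports Complex_Main "HOL-Computational_Algebra.Computational_Algebra"
begin

definition chebyshev_T :: "nat \<Rightarrow> real poly" where
  "chebyshev_T k = (THE p. \<forall>\<theta>. poly p (cos \<theta>) = cos (real k * \<theta>))"

lemma chebyshev_T_exists: "\<exists>p. \<forall>\<theta>. poly p (cos \<theta>) = cos (real k * \<theta>)"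
proof (induction k rule: less_induct)
  case (less k)
  consider "k = 0" | "k = 1" | j where "k = Suc (Suc j)"
    by (metis One_nat_def not0_implies_Suc)
  then show ?case
  proof cases
    case 1
    then show ?thesis by (intro exI[of _ 1]) simp
  next
    case 2
    then show ?thesis by (intro exI[of _ "[:0, 1:]"]) simp
  next
    case 3
    obtain p where p: "\<And>\<theta>. poly p (cos \<theta>) = cos (real j * \<theta>)"
      using less.IH[of j] 3 by auto
    obtain q where q: "\<And>\<theta>. poly q (cos \<theta>) = cos (real (Suc j) * \<theta>)"
      using less.IH[of "Suc j"] 3 by blast
    have "poly ([:0, 2:] * q - p) (cos \<theta>) = cos (real k * \<theta>)" for \<theta>
    proof -
      have "cos (real k * \<theta>) = cos (real (Suc j) * \<theta> + \<theta>)"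
        by (simp add: 3 algebra_simps)
      moreover have "cos (real j * \<theta>) = cos (real (Suc j) * \<theta> - \<theta>)"
        by (simp add: algebra_simps)
      ultimately show ?thesis
        unfolding poly_diff poly_mult p q cos_add cos_diff by simp
    qed
    then show ?thesis by blast
  qed
qed

lemma chebyshev_T_unique:
  assumes "\<And>\<theta>. poly p (cos \<theta>) = cos (real k * \<theta>)" "\<And>\<theta>. poly q (cos \<theta>) = cos (real k * \<theta>)"
  shows "p = q"
proof (rule ccontr)
  assume "p \<noteq> q"
  then have "finite {x. poly (p - q) x = 0}"
    by (intro poly_roots_finite) simp
  moreover have "{-1..1} \<subseteq> {x. poly (p - q) x = 0}"
  proof
    fix x :: real
    assume "x \<in> {-1..1}"
    then have "x = cos (arccos x)"
      by (simp add: cos_arccos)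
    then show "x \<in> {x. poly (p - q) x = 0}"
      using assms[of "arccos x"] by simp
  qed
  ultimately have "finite {-1..1::real}"
    by (rule finite_subset[rotated])
  then show False
    using infinite_Icc[of "-1::real" 1] by simp
qed

lemma poly_chebyshev_T_cos: "poly (chebyshev_T k) (cos \<theta>) = cos (real k * \<theta>)"
proof -
  have "\<exists>!p. \<forall>\<theta>. poly p (cos \<theta>) = cos (real k * \<theta>)"
    using chebyshev_T_exists[of k] chebyshev_T_unique by blast
  from theI'[OF this] show ?thesis
    unfolding chebyshev_T_def by blast
qed

text \<open>
  \<^typ>\<open>real poly poly\<close> plays the role of the ring of real polynomials in two variables:
  the inner variable is \<open>x\<close>, the outer one is \<open>y\<close>.
\<close>

definition in_x :: "'a::comm_ring_1 poly \<Rightarrow> 'a poly poly" where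
  "in_x p = [:p:]"

definition in_y :: "'a::comm_ring_1 poly \<Rightarrow> 'a poly poly" where
  "in_y p = map_poly (\<lambda>c. [:c:]) p"

definition const2 :: "'a::comm_ring_1 \<Rightarrow> 'a poly poly" where
  "const2 c = [:[:c:]:]"

lemma eval_in_x: "poly (poly (in_x p) [:y:]) x = poly p x"
  by (simp add: in_x_def)

lemma eval_in_y: "poly (poly (in_y p) [:y:]) x = poly p y"
  by (induction p) (simp_all add: in_y_def map_poly_pCons)

lemma eval_const2: "poly (poly (const2 c) [:y:]) x = c"
  by (simp add: const2_def)

end

theory Submission
  imports Defs
begin

text \<open>
  The curve is parametrised by \<open>x = cos (m t + \<delta> / n)\<close>, \<open>y = cos (n t)\<close>. Along it every polynomial
  in \<open>x, y\<close> becomes a trigonometric polynomial in \<open>t\<close>, so if \<open>F = A B\<close> then one factor, say \<open>A\<close>,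
  vanishes on the whole curve. Over a generic \<open>y = cos \<theta>\<close> the curve has \<open>2 n\<close> points with distinct
  \<open>x\<close>, because \<open>m\<close> and \<open>n\<close> are coprime and \<open>sin \<delta> \<noteq> 0\<close>. Hence \<open>A(\<cdot>, y)\<close> already has the full
  degree \<open>2 n\<close> of \<open>F(\<cdot>, y)\<close>, and \<open>B\<close> does not depend on \<open>x\<close>. As \<open>F\<close> takes the form
  \<open>X\<^sup>2 - 2 c X Y + Y\<^sup>2 - s\<^sup>2\<close>, its second difference at \<open>X = 1, 0, -1\<close> is \<open>2\<close>; since \<open>B\<close> divides it,
  \<open>B\<close> is constant.
\<close>

subsection \<open>Chebyshev polynomials\<close>

text \<open>Induction along T_{j+2} = 2 x T_{j+1} - T_j, which the cosine addition formulas give;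
  each step raises the degree bound by one.\<close>

lemma degree_chebyshev_T_le: "degree (chebyshev_T k) \<le> k"
proof (induction k rule: less_induct)
  case (less k)
  have eqI: "chebyshev_T k = p" if "\<And>\<theta>. poly p (cos \<theta>) = cos (real k * \<theta>)" for p
    by (rule chebyshev_T_unique[OF poly_chebyshev_T_cos that])
  consider "k = 0" | "k = 1" | j where "k = Suc (Suc j)"
    by (metis One_nat_def not0_implies_Suc)
  then show ?case
  proof cases
    case 1
    then have "chebyshev_T k = 1" by (intro eqI) simp
    then show ?thesis by simp
  next
    case 2
    then have "chebyshev_T k = [:0, 1:]" by (intro eqI) simp
    then show ?thesis using 2 by simp
  next
    case 3
    let ?p = "chebyshev_T j" and ?q = "chebyshev_T (Suc j)"
    have "chebyshev_T k = [:0, 2:] * ?q - ?p"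
    proof (rule eqI)
      fix \<theta> :: real
      have "cos (real k * \<theta>) = cos (real (Suc j) * \<theta> + \<theta>)"
        by (simp add: 3 algebra_simps)
      moreover have "cos (real j * \<theta>) = cos (real (Suc j) * \<theta> - \<theta>)"
        by (simp add: algebra_simps)
      ultimately show "poly ([:0, 2:] * ?q - ?p) (cos \<theta>) = cos (real k * \<theta>)"
        unfolding poly_diff poly_mult poly_chebyshev_T_cos cos_add cos_diff by simp
    qed
    moreover have "degree ([:0, 2:] * ?q) \<le> k"
    proof -
      have "degree ([:0, 2:] * ?q) \<le> degree [:0, 2::real:] + degree ?q"
        by (rule degree_mult_le)
      also have "\<dots> \<le> 1 + Suc j"
        using less.IH[of "Suc j"] 3 by (intro add_mono) auto
      finally show ?thesis using 3 by simp
    qed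
    moreover have "degree ?p \<le> k"
      using less.IH[of j] 3 by simp
    ultimately show ?thesis
      by (simp add: degree_diff_le)
  qed
qed

text \<open>Supplies the nodes X = 1, 0, -1 for second differences in X = T_n(x).\<close>

lemma chebyshev_T_values:
  assumes "n > 0"
  obtains x1 x0 x' where "poly (chebyshev_T n) x1 = 1" "poly (chebyshev_T n) x0 = 0"
    "poly (chebyshev_T n) x' = -1"
proof
  show "poly (chebyshev_T n) (cos 0) = 1"
    by (subst poly_chebyshev_T_cos) simp
  show "poly (chebyshev_T n) (cos (pi / (2 * n))) = 0"
    using assms by (subst poly_chebyshev_T_cos) simp
  show "poly (chebyshev_T n) (cos (pi / n)) = -1"
    using assms by (subst poly_chebyshev_T_cos) simp
qed

subsection \<open>Trigonometric polynomials\<close>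

text \<open>These are the Laurent polynomials in \<open>cis t\<close>: the factor
  \<open>cis t ^ N\<close> clears negative exponents, so that ordinary complex polynomials
  suffice.\<close>

definition trig_poly :: "(real \<Rightarrow> complex) \<Rightarrow> bool" where
  "trig_poly f \<longleftrightarrow> (\<exists>N P. \<forall>t. cis t ^ N * f t = poly P (cis t))"

lemma trig_poly_const: "trig_poly (\<lambda>t. c)"
  unfolding trig_poly_def by (intro exI[of _ 0] exI[of _ "[:c:]"]) simp

lemma trig_poly_cos: "trig_poly (\<lambda>t. complex_of_real (cos (real k * t + \<epsilon>)))"
proof -
  have "cis t ^ k * complex_of_real (cos (real k * t + \<epsilon>))
      = poly (monom (cis \<epsilon> / 2) (2 * k) + [:cis (- \<epsilon>) / 2:]) (cis t)" for t
  proof -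
    \<comment> \<open>\<open>w\<close> is the inverse of \<open>z\<close>, so multiplying Euler's
      formula for the cosine by \<open>z\<close> leaves a polynomial in
      \<open>cis t\<close>.\<close>
    define z w where "z = cis t ^ k" and "w = cis (- (real k * t))"
    have "complex_of_real (cos a) = (cis a + cis (- a)) / 2" for a
      by (simp add: complex_eq_iff)
    then have "complex_of_real (cos (real k * t + \<epsilon>)) =
        (cis (real k * t + \<epsilon>) + cis (- (real k * t + \<epsilon>))) / 2"
      by blast
    also have "cis (real k * t + \<epsilon>) = cis \<epsilon> * z"
      unfolding z_def by (simp add: DeMoivre cis_mult add.commute)
    also have "cis (- (real k * t + \<epsilon>)) = cis (- \<epsilon>) * w"
      unfolding w_def by (simp add: cis_mult algebra_simps)
    finally have cos_zw: "complex_of_real (cos (real k * t + \<epsilon>)) =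
        (cis \<epsilon> * z + cis (- \<epsilon>) * w) / 2" .
    have "z * w = 1"
      unfolding z_def w_def by (simp add: DeMoivre cis_mult)
    then have "z * ((cis \<epsilon> * z + cis (- \<epsilon>) * w) / 2) = cis \<epsilon> / 2 * (z * z) + cis (- \<epsilon>) / 2"
      by (simp add: field_simps)
    moreover have "cis t ^ (2 * k) = z * z"
      by (simp add: z_def mult_2 power_add)
    ultimately show ?thesis
      unfolding cos_zw z_def[symmetric] by (simp add: poly_monom)
  qed
  then show ?thesis unfolding trig_poly_def by blast
qed

lemma trig_poly_mult:
  assumes "trig_poly f" "trig_poly g"
  shows "trig_poly (\<lambda>t. f t * g t)"
proof -
  obtain N P M Q where "\<And>t. cis t ^ N * f t = poly P (cis t)" "\<And>t. cis t ^ M * g t = poly Q (cis t)"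
    using assms unfolding trig_poly_def by blast
  then have "cis t ^ (N + M) * (f t * g t) = poly (P * Q) (cis t)" for t
    by (metis (no_types, opaque_lifting) poly_mult power_add mult.assoc mult.left_commute)
  then show ?thesis unfolding trig_poly_def by blast
qed

lemma trig_poly_add:
  assumes "trig_poly f" "trig_poly g"
  shows "trig_poly (\<lambda>t. f t + g t)"
proof -
  obtain N P M Q where P: "\<And>t. cis t ^ N * f t = poly P (cis t)"
    and Q: "\<And>t. cis t ^ M * g t = poly Q (cis t)"
    using assms unfolding trig_poly_def by blast
  have "cis t ^ (N + M) * (f t + g t) = poly (monom 1 M * P + monom 1 N * Q) (cis t)" for t
    by (simp add: poly_monom power_add algebra_simps flip: P Q)
  then show ?thesis unfolding trig_poly_def by blast
qed

lemma trig_poly_compose_poly: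
  fixes p :: "real poly"
  assumes "trig_poly (\<lambda>t. complex_of_real (f t))"
  shows "trig_poly (\<lambda>t. complex_of_real (poly p (f t)))"
proof (induction p)
  case 0
  show ?case using trig_poly_const[of 0] by simp
next
  case (pCons a p)
  show ?case
    using trig_poly_add[OF trig_poly_const[of "complex_of_real a"] trig_poly_mult[OF assms pCons.IH]]
    by simp
qed

lemma trig_poly_compose_poly2:
  fixes A :: "real poly poly"
  assumes "trig_poly (\<lambda>t. complex_of_real (f t))" "trig_poly (\<lambda>t. complex_of_real (g t))"
  shows "trig_poly (\<lambda>t. complex_of_real (poly (poly A [:g t:]) (f t)))"
proof (induction A)
  case 0
  show ?case using trig_poly_const[of 0] by simp
next
  case (pCons a A)
  show ?case
    using trig_poly_add[OF trig_poly_compose_poly[OF assms(1), of a] trig_poly_mult[OF assms(2) pCons.IH]]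
    by simp
qed

text \<open>The product of the two numerators has infinitely many roots on the unit circle, so it is
  zero and one numerator is zero; \<open>cis t\<close> never vanishes.\<close>

lemma trig_poly_no_zero_divisors:
  assumes "trig_poly f" "trig_poly g" "\<And>t. f t * g t = 0"
  shows "(\<forall>t. f t = 0) \<or> (\<forall>t. g t = 0)"
proof -
  obtain N P M Q where P: "\<And>t. cis t ^ N * f t = poly P (cis t)"
    and Q: "\<And>t. cis t ^ M * g t = poly Q (cis t)"
    using assms unfolding trig_poly_def by blast
  have "poly (P * Q) (cis t) = 0" for t
    using assms(3)[of t] by (auto simp flip: P Q)
  then have "cis ` {0<..<pi} \<subseteq> {z. poly (P * Q) z = 0}"
    by blast
  moreover have "infinite (cis ` {0<..<pi})"
  proof -
    have "inj_on cis {0<..<pi}"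
      by (rule inj_onI) (metis Re_complex_of_real cis.sel(1) cos_inj_pi greaterThanLessThan_iff less_imp_le)
    then show ?thesis
      by (simp add: finite_image_iff)
  qed
  ultimately have "P * Q = 0"
    using poly_roots_finite finite_subset by blast
  then consider "P = 0" | "Q = 0"
    by auto
  then show ?thesis
    using P Q by cases auto
qed

subsection \<open>Bivariate polynomials as functions\<close>

text \<open>Evaluating at \<open>[:y:]\<close> fixes the outer variable; here the inner one is fixed
  instead, by evaluating each coefficient of \<open>A\<close> at \<open>x\<close>.\<close>

lemma poly_poly_slice:
  fixes A :: "'a::comm_ring_1 poly poly"
  obtains g where "\<And>y. poly g y = poly (poly A [:y:]) x"
proof -
  have "\<exists>g. \<forall>y. poly g y = poly (poly A [:y:]) x"
  proof (induction A)
    case 0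
    show ?case by (intro exI[of _ 0]) simp
  next
    case (pCons a A)
    then obtain g where "\<forall>y. poly g y = poly (poly A [:y:]) x" by blast
    then show ?case by (intro exI[of _ "pCons (poly a x) g"]) simp
  qed
  then show ?thesis using that by blast
qed

lemma poly_eqI_infinite:
  fixes p q :: "'a::idom poly"
  assumes "infinite Y" "\<And>y. y \<in> Y \<Longrightarrow> poly p y = poly q y"
  shows "p = q"
proof (rule ccontr)
  assume "p \<noteq> q"
  then have "finite {y. poly (p - q) y = 0}"
    by (intro poly_roots_finite) simp
  moreover have "Y \<subseteq> {y. poly (p - q) y = 0}"
    using assms(2) by auto
  ultimately show False
    using assms(1) finite_subset by blast
qed

subsection \<open>Points of the curve over a generic ordinate\<close>

text \<open>Equal cosines force half the sum or half the difference of the arguments into the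
  multiples of pi. The sine conditions exclude the sum and force equal signs; coprimality then
  forces equal \<open>k\<close>.\<close>

lemma lissajous_fibre_inj:
  fixes m n :: nat and \<delta> \<theta> :: real
  assumes "n > 0" "coprime m n" "sin \<delta> \<noteq> 0"
    and "sin (m * \<theta>) \<noteq> 0" "sin (m * \<theta> + \<delta>) \<noteq> 0" "sin (m * \<theta> - \<delta>) \<noteq> 0"
  shows "inj_on (\<lambda>(s, k). cos (m * ((real_of_int s * \<theta> + 2 * pi * real k) / n) + \<delta> / n))
    ({1, -1} \<times> {..<n})"
proof -
  let ?a = "\<lambda>s k. m * ((real_of_int s * \<theta> + 2 * pi * real k) / n) + \<delta> / n"
  \<comment> \<open>Multiples of pi survive scaling by \<open>n\<close> and integer shifts; this
    clears the denominator \<open>n\<close> and drops the terms in \<open>k\<close>.\<close>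
  have sin0: "sin (n * x + pi * of_int i) = 0" if x: "sin x = 0" for x :: real and i :: int
  proof -
    obtain l where "x = of_int l * pi" using x by (auto simp: sin_zero_iff_int2)
    then have "n * x + pi * of_int i = of_int (int n * l + i) * pi" by (simp add: algebra_simps)
    then show ?thesis by (metis sin_zero_iff_int2)
  qed
  have cos_eqD: "sin ((a + b) / 2) = 0 \<or> sin ((b - a) / 2) = 0" if "cos a = cos b" for a b :: real
    using that cos_diff_cos[of a b] by simp
  have key: "s = s' \<and> k = k'"
    if s: "s \<in> {1, -1}" "s' \<in> {1, -1}" and k: "k < n" "k' < n" and eq: "cos (?a s k) = cos (?a s' k')"
    for s s' :: int and k k'
  proof -
    from cos_eqD[OF eq] show ?thesis
    proof
      assume *: "sin ((?a s k + ?a s' k') / 2) = 0"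
      moreover have "n * ((?a s k + ?a s' k') / 2) + pi * of_int (- (int m * (int k + int k')))
          = m * (\<theta> * of_int (s + s') / 2) + \<delta>"
        using \<open>n > 0\<close> by (simp add: field_simps)
      ultimately have "sin (m * (\<theta> * of_int (s + s') / 2) + \<delta>) = 0"
        using sin0[OF *, of "- (int m * (int k + int k'))"] by (simp only:)
      moreover have "sin (- (m * \<theta>) + \<delta>) = - sin (m * \<theta> - \<delta>)"
        by (metis minus_diff_eq sin_minus uminus_add_conv_diff)
      \<comment> \<open>As \<open>s + s'\<close> is 2, 0 or -2, the argument of the sine is m
        \<theta> + \<delta>, \<delta> or -m \<theta> + \<delta>.\<close>
      ultimately have False
        using s assms(3-6) by auto
      then show ?thesis ..
    next
      assume *: "sin ((?a s' k' - ?a s k) / 2) = 0"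
      moreover have "n * ((?a s' k' - ?a s k) / 2) + pi * of_int (int m * (int k - int k'))
          = m * (\<theta> * of_int (s' - s) / 2)"
        using \<open>n > 0\<close> by (simp add: field_simps)
      ultimately have "sin (m * (\<theta> * of_int (s' - s) / 2)) = 0"
        using sin0[OF *, of "int m * (int k - int k')"] by (simp only:)
      then have ss: "s = s'"
        using s assms(4) by auto
      \<comment> \<open>With equal signs \<theta> cancels, and what remains is the divisibility of m
        (k' - k) by n, where |k' - k| < n.\<close>
      obtain l where "(?a s' k' - ?a s k) / 2 = of_int l * pi"
        using * by (auto simp: sin_zero_iff_int2)
      moreover have "(?a s' k' - ?a s k) / 2 = m * (real k' - real k) * pi / n"
        using \<open>n > 0\<close> ss by (simp add: field_simps)
      ultimately have "m * (real k' - real k) * pi = n * of_int l * pi"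
        using \<open>n > 0\<close> by (simp add: field_simps)
      then have "of_int (int m * (int k' - int k)) = (of_int (int n * l) :: real)"
        by simp
      then have "int m * (int k' - int k) = int n * l"
        by (simp only: of_int_eq_iff)
      then have "int n dvd int k' - int k"
        using \<open>coprime m n\<close> coprime_dvd_mult_right_iff[of "int n" "int m" "int k' - int k"]
        by (simp add: coprime_commute)
      then have "k = k'"
        using k dvd_imp_le_int[of "int k' - int k" "int n"] by linarith
      with ss show ?thesis by simp
    qed
  qed
  show ?thesis
  proof (rule inj_onI)
    fix p q
    assume "p \<in> {1, -1} \<times> {..<n}" "q \<in> {1, -1} \<times> {..<n}"
      and "(case p of (s, k) \<Rightarrow> cos (?a s k)) = (case q of (s, k) \<Rightarrow> cos (?a s k))"
    then show "p = q"
      using key[of "fst p" "fst q" "snd p" "snd q"]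
      by (simp only: mem_Times_iff lessThan_iff case_prod_unfold prod_eq_iff)
  qed
qed

text \<open>As \<theta> tends to 0 from the right, sin (m \<theta> + \<delta>) and sin (m \<theta> -
  \<delta>) tend to the nonzero values sin \<delta> and -sin \<delta>, while sin (m \<theta>) is
  positive below pi / m.\<close>

lemma generic_angles:
  fixes m :: nat and \<delta> :: real
  assumes "m > 0" "sin \<delta> \<noteq> 0"
  obtains \<eta> where "0 < \<eta>" "\<eta> \<le> pi"
    "\<And>\<theta> :: real. 0 < \<theta> \<Longrightarrow> \<theta> < \<eta> \<Longrightarrow> sin (m * \<theta>) \<noteq> 0 \<and> sin (m * \<theta> + \<delta>) \<noteq> 0 \<and> sin (m * \<theta> - \<delta>) \<noteq> 0"
proof -
  have "\<forall>\<^sub>F \<theta> in at_right (0::real). sin (m * \<theta> + \<delta>) \<noteq> 0"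
    by (rule tendsto_imp_eventually_ne[where c = "sin (m * 0 + \<delta>)"])
      (use assms in \<open>auto intro!: tendsto_eq_intros\<close>)
  moreover have "\<forall>\<^sub>F \<theta> in at_right (0::real). sin (m * \<theta> - \<delta>) \<noteq> 0"
    by (rule tendsto_imp_eventually_ne[where c = "sin (m * 0 - \<delta>)"])
      (use assms in \<open>auto intro!: tendsto_eq_intros\<close>)
  ultimately have "\<forall>\<^sub>F \<theta> in at_right (0::real). sin (m * \<theta> + \<delta>) \<noteq> 0 \<and> sin (m * \<theta> - \<delta>) \<noteq> 0"
    by eventually_elim simp
  then obtain b where b: "b > 0"
    "\<And>\<theta> :: real. 0 < \<theta> \<Longrightarrow> \<theta> < b \<Longrightarrow> sin (m * \<theta> + \<delta>) \<noteq> 0 \<and> sin (m * \<theta> - \<delta>) \<noteq> 0"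
    by (auto simp: eventually_at_right_field)
  have m: "sin (m * \<theta>) \<noteq> 0" if "0 < \<theta>" "\<theta> < pi / m" for \<theta> :: real
    using that assms sin_gt_zero[of "m * \<theta>"] by (simp add: field_simps)
  have "pi / m \<le> pi"
    using assms by (simp add: field_simps)
  then show ?thesis
    using b m assms by (intro that[of "min b (pi / m)"]) auto
qed

subsection \<open>The factor that vanishes on the curve\<close>

definition lissajous_poly :: "nat \<Rightarrow> nat \<Rightarrow> real \<Rightarrow> real poly poly" where
  "lissajous_poly m n \<delta> = (in_x (chebyshev_T n))\<^sup>2
      - 2 * in_x (chebyshev_T n) * in_y (chebyshev_T m) * const2 (cos \<delta>)
      + (in_y (chebyshev_T m))\<^sup>2
      - const2 ((sin \<delta>)\<^sup>2)"

lemma poly_in_y: "poly (in_y p) [:y:] = [:poly p y:]"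
  by (induction p) (simp_all add: in_y_def map_poly_pCons)

lemma poly_lissajous_poly:
  "poly (lissajous_poly m n \<delta>) [:y:] =
    (chebyshev_T n)\<^sup>2 - smult (2 * poly (chebyshev_T m) y * cos \<delta>) (chebyshev_T n)
      + [:(poly (chebyshev_T m) y)\<^sup>2 - (sin \<delta>)\<^sup>2:]"
proof -
  show ?thesis
    by (rule poly_eqI_infinite[OF infinite_UNIV_char_0])
      (simp add: lissajous_poly_def in_x_def const2_def poly_in_y algebra_simps)
qed

lemma eval_lissajous_poly:
  "poly (poly (lissajous_poly m n \<delta>) [:y:]) x =
    (poly (chebyshev_T n) x)\<^sup>2 - 2 * poly (chebyshev_T n) x * poly (chebyshev_T m) y * cos \<delta>
      + (poly (chebyshev_T m) y)\<^sup>2 - (sin \<delta>)\<^sup>2"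
  by (simp add: poly_lissajous_poly)

lemma degree_lissajous_poly_slice: "degree (poly (lissajous_poly m n \<delta>) [:y:]) \<le> 2 * n"
proof -
  have "degree ((chebyshev_T n)\<^sup>2) \<le> 2 * n"
    using degree_power_le[of "chebyshev_T n" 2] degree_chebyshev_T_le[of n] by linarith
  moreover have "degree (smult c (chebyshev_T n)) \<le> 2 * n" for c
    using degree_smult_le[of c "chebyshev_T n"] degree_chebyshev_T_le[of n] by linarith
  moreover have "degree [:c:] \<le> 2 * n" for c :: real
    by simp
  ultimately show ?thesis
    unfolding poly_lissajous_poly by (intro degree_add_le degree_diff_le)
qed

text \<open>A slice is a monic quadratic in T_n(x), so it cannot vanish at all three of T_n(x) = 1,
  0, -1.\<close>

lemma lissajous_poly_slice_nonzero:
  assumes "n > 0"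
  shows "poly (lissajous_poly m n \<delta>) [:y:] \<noteq> 0"
proof
  assume *: "poly (lissajous_poly m n \<delta>) [:y:] = 0"
  obtain x1 x0 x' where "poly (chebyshev_T n) x1 = 1" "poly (chebyshev_T n) x0 = 0"
    "poly (chebyshev_T n) x' = -1"
    using chebyshev_T_values[OF assms] .
  then show False
    using eval_lissajous_poly[of m n \<delta> y x1] eval_lissajous_poly[of m n \<delta> y x0]
      eval_lissajous_poly[of m n \<delta> y x'] *
    by simp
qed

lemma lissajous_poly_on_curve:
  fixes t :: real
  assumes "n > 0"
  shows "poly (poly (lissajous_poly m n \<delta>) [:cos (n * t):]) (cos (m * t + \<delta> / n)) = 0"
proof -
  \<comment> \<open>On the curve T_m(y) = cos b and T_n(x) = cos (b + \<delta>).\<close>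
  define b where "b = real m * (real n * t)"
  have "real n * (m * t + \<delta> / n) = b + \<delta>"
    using assms by (simp add: b_def field_simps)
  then have "poly (poly (lissajous_poly m n \<delta>) [:cos (n * t):]) (cos (m * t + \<delta> / n))
    = (cos (b + \<delta>))\<^sup>2 - 2 * cos (b + \<delta>) * cos b * cos \<delta> + (cos b)\<^sup>2 - (sin \<delta>)\<^sup>2"
    by (simp add: eval_lissajous_poly poly_chebyshev_T_cos b_def)
  also have "\<dots> = (cos b)\<^sup>2 * (1 - (cos \<delta>)\<^sup>2) - (1 - (sin b)\<^sup>2) * (sin \<delta>)\<^sup>2"
    by (simp add: cos_add power2_eq_square algebra_simps)
  also have "\<dots> = 0"
    by (simp add: sin_squared_eq)
  finally show ?thesis .
qed

text \<open>Stated for the factor \<open>A\<close> that vanishes on the curve; by symmetry it serves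
  both cases of a factorisation.\<close>

lemma cofactor_unit:
  fixes m n :: nat and \<delta> :: real and A B :: "real poly poly"
  assumes "m > 0" "n > 0" "coprime m n" "sin \<delta> \<noteq> 0"
    and AB: "lissajous_poly m n \<delta> = A * B"
    and A0: "\<And>t :: real. poly (poly A [:cos (n * t):]) (cos (m * t + \<delta> / n)) = 0"
  shows "B dvd 1"
proof -
  obtain \<eta> where \<eta>: "0 < \<eta>" "\<eta> \<le> pi"
    "\<And>\<theta> :: real. 0 < \<theta> \<Longrightarrow> \<theta> < \<eta> \<Longrightarrow> sin (m * \<theta>) \<noteq> 0 \<and> sin (m * \<theta> + \<delta>) \<noteq> 0 \<and> sin (m * \<theta> - \<delta>) \<noteq> 0"
    using generic_angles[of m \<delta>] assms by metis
  \<comment> \<open>An infinite set of generic ordinates, since the cosine is injective below \<eta>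
    \<le> pi; polynomial identities need only be checked on it.\<close>
  define Y where "Y = cos ` {0<..<\<eta>}"
  have "inj_on cos {0<..<\<eta>}"
    using \<eta> by (auto intro!: inj_onI cos_inj_pi)
  then have "infinite Y"
    using \<eta>(1) by (simp add: Y_def finite_image_iff)
  have slice: "poly (lissajous_poly m n \<delta>) [:y:] = poly A [:y:] * poly B [:y:]" for y
    using AB by simp
  have const: "degree (poly B [:y:]) = 0" if y: "y \<in> Y" for y
  proof -
    obtain \<theta> where \<theta>: "y = cos \<theta>" "0 < \<theta>" "\<theta> < \<eta>"
      using y by (auto simp: Y_def)
    \<comment> \<open>The 2 n parameters solving n t = s \<theta> + 2 pi k, all with ordinate
      \<open>y\<close>.\<close>
    let ?t = "\<lambda>(s, k). (real_of_int s * \<theta> + 2 * pi * real k) / n"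
    let ?I = "{1, -1} \<times> {..<n}"
    have inj: "inj_on (\<lambda>i. cos (m * ?t i + \<delta> / n)) ?I"
      using lissajous_fibre_inj[OF assms(2-4), of \<theta>] \<eta>(3)[of \<theta>] \<theta>
      by (simp add: case_prod_unfold)
    have "poly (poly A [:y:]) (cos (m * ?t i + \<delta> / n)) = 0" if i: "i \<in> ?I" for i
    proof -
      obtain s k where sk: "i = (s, k)" "s = 1 \<or> s = -1"
        using i by auto
      have "cos (real n * ?t i) = cos (real_of_int s * \<theta> + 2 * pi * real k)"
        using \<open>n > 0\<close> sk by simp
      also have "\<dots> = cos (real_of_int s * \<theta>)"
        using cos_int_2pin[of "int k"] sin_int_2pin[of "int k"] by (simp add: cos_add)
      also have "\<dots> = y"
        using sk \<theta> by auto
      finally show ?thesis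
        using A0[of "?t i"] by simp
    qed
    then have sub: "(\<lambda>i. cos (m * ?t i + \<delta> / n)) ` ?I \<subseteq> {x. poly (poly A [:y:]) x = 0}"
      by blast
    have nz: "poly A [:y:] \<noteq> 0" "poly B [:y:] \<noteq> 0"
      using lissajous_poly_slice_nonzero[OF \<open>n > 0\<close>, of m \<delta> y] slice[of y] by auto
    \<comment> \<open>The 2 n distinct roots make the slice of \<open>A\<close> exhaust the degree,
      leaving degree 0 for the slice of \<open>B\<close>.\<close>
    have "2 * n = card ((\<lambda>i. cos (m * ?t i + \<delta> / n)) ` ?I)"
      using inj by (simp add: card_image card_cartesian_product)
    also have "\<dots> \<le> card {x. poly (poly A [:y:]) x = 0}"
      by (rule card_mono[OF poly_roots_finite[OF nz(1)] sub])
    also have "\<dots> \<le> degree (poly A [:y:])"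
      using card_poly_roots_bound[OF nz(1)] by simp
    finally have "2 * n \<le> degree (poly A [:y:])" .
    moreover have "degree (poly A [:y:]) + degree (poly B [:y:]) \<le> 2 * n"
      using degree_lissajous_poly_slice[of m n \<delta> y] nz by (simp add: slice degree_mult_eq)
    ultimately show ?thesis by simp
  qed
  obtain x1 x0 x' where x: "poly (chebyshev_T n) x1 = 1" "poly (chebyshev_T n) x0 = 0"
    "poly (chebyshev_T n) x' = -1"
    using chebyshev_T_values[OF \<open>n > 0\<close>] .
  obtain b where b: "\<And>y. poly b y = poly (poly B [:y:]) x0"
    using poly_poly_slice[of B x0] by blast
  obtain a1 where a1: "\<And>y. poly a1 y = poly (poly A [:y:]) x1"
    using poly_poly_slice[of A x1] by blast
  obtain a0 where a0: "\<And>y. poly a0 y = poly (poly A [:y:]) x0"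
    using poly_poly_slice[of A x0] by blast
  obtain a' where a': "\<And>y. poly a' y = poly (poly A [:y:]) x'"
    using poly_poly_slice[of A x'] by blast
  \<comment> \<open>A slice constant in x can be read off at any abscissa; \<open>x0\<close> is the
    one chosen for \<open>b\<close>.\<close>
  have B: "poly B [:y:] = [:poly b y:]" if "y \<in> Y" for y
    using const[OF that] b[of y] by (auto elim: degree_eq_zeroE)
  \<comment> \<open>Second difference in X = T_n(x): the linear and constant terms of X^2 - 2 c X Y
    + Y^2 - s^2 cancel, leaving 2, and \<open>b\<close> factors out as it is the same at all three
    nodes.\<close>
  have "(a1 + a' - smult 2 a0) * b = [:2:]"
  proof (rule poly_eqI_infinite[OF \<open>infinite Y\<close>])
    fix y assume "y \<in> Y"
    then have "poly (poly (lissajous_poly m n \<delta>) [:y:]) x = poly (poly A [:y:]) x * poly b y" for x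
      by (simp add: slice B)
    then have "poly ((a1 + a' - smult 2 a0) * b) y =
      poly (poly (lissajous_poly m n \<delta>) [:y:]) x1 + poly (poly (lissajous_poly m n \<delta>) [:y:]) x'
        - 2 * poly (poly (lissajous_poly m n \<delta>) [:y:]) x0"
      by (simp add: a1 a0 a' algebra_simps)
    then show "poly ((a1 + a' - smult 2 a0) * b) y = poly [:2:] y"
      by (simp add: eval_lissajous_poly x)
  qed
  then have "b dvd [:2:]"
    by (metis dvd_triv_right)
  then have "degree b = 0" "b \<noteq> 0"
    using dvd_imp_degree_le[of b "[:2:]"] by auto
  then obtain c where c: "b = [:c:]" "c \<noteq> 0"
    by (auto elim: degree_eq_zeroE)
  \<comment> \<open>Both sides are polynomials over the domain of polynomials in x and agree at the
    infinitely many elements \<open>[:y:]\<close> of it with \<open>y\<close> in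
    \<open>Y\<close>.\<close>
  have "B = const2 c"
  proof (rule poly_eqI_infinite)
    show "infinite ((\<lambda>y. [:y:]) ` Y)"
      using \<open>infinite Y\<close> by (simp add: finite_image_iff inj_on_def)
  qed (auto simp: B c const2_def)
  then have "B * const2 (1 / c) = 1"
    using c by (simp add: const2_def one_pCons)
  then show ?thesis
    by (metis dvd_triv_left)
qed

theorem theorem3:
  fixes m n :: nat and \<delta> :: real
  assumes "m > 0" and "n > 0" and "coprime m n" and "sin \<delta> \<noteq> 0"
  shows "irreducible
    ((in_x (chebyshev_T n))\<^sup>2
      - 2 * in_x (chebyshev_T n) * in_y (chebyshev_T m) * const2 (cos \<delta>)
      + (in_y (chebyshev_T m))\<^sup>2
      - const2 ((sin \<delta>)\<^sup>2) :: real poly poly)"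
  unfolding lissajous_poly_def[symmetric]
proof (rule irreducibleI)
  let ?F = "lissajous_poly m n \<delta>"
  let ?ev = "\<lambda>A (t :: real). poly (poly A [:cos (n * t):]) (cos (m * t + \<delta> / n))"
  show "?F \<noteq> 0"
    using lissajous_poly_slice_nonzero[OF \<open>n > 0\<close>, of m \<delta> 0] by auto
  show "\<not> ?F dvd 1"
  proof
    \<comment> \<open>A unit has no zeros, but \<open>?F\<close> vanishes at the curve point with
      parameter 0.\<close>
    assume "?F dvd 1"
    then obtain G where "1 = ?F * G" by (rule dvdE)
    then have "?ev 1 0 = ?ev ?F 0 * ?ev G 0"
      by (metis poly_mult)
    then show False
      using lissajous_poly_on_curve[OF \<open>n > 0\<close>, of m \<delta> 0] by simp
  qed
  fix A B
  assume AB: "?F = A * B"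
  have trig: "trig_poly (\<lambda>t. complex_of_real (?ev C t))" for C
    using trig_poly_compose_poly2[OF trig_poly_cos trig_poly_cos[of n 0]] by simp
  have "complex_of_real (?ev A t) * complex_of_real (?ev B t) = 0" for t
    using lissajous_poly_on_curve[OF \<open>n > 0\<close>, of m \<delta> t] by (simp add: AB)
  \<comment> \<open>The product vanishes pointwise; the absence of zero divisors makes a single
    factor vanish along the entire curve.\<close>
  from trig_poly_no_zero_divisors[OF trig trig this]
  consider "\<And>t. ?ev A t = 0" | "\<And>t. ?ev B t = 0"
    by auto
  then show "A dvd 1 \<or> B dvd 1"
  proof cases
    case 1
    then show ?thesis using cofactor_unit[OF assms AB] by blast
  next
    case 2
    then show ?thesis using cofactor_unit[OF assms, of B A] AB by (simp add: mult.commute)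
  qed
qed

end
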